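(* For any graph $\Gamma$, $$w(\Gamma)\le \Delta(\Gamma)\cdot\bigl(tw(\Gamma)+1\bigr),$$ where $w(\Gamma)$ is the contraction-width of $\Gamma$, $\Delta(\Gamma)$ is the maximum degree of $\Gamma$, and $tw(\Gamma)$ is the tree-width of $\Gamma$.
   Context: **Tree-width.** A tree decomposition of a graph $\Gamma=(V,E)$ is a tree $T$ whose vertices consist of subsets $X_i$ of $V$ such that (a) $\bigcup_i X_i=V$; (b) if $v\in X_i\cap X_j$, then any $X_k$ in the path in $T$ connecting $X_i$ and $X_j$ also contains $v$; (c) for every edge $\{v,w\}\in E$ there exists $X_i$ such that $v,w\in X_i$. The width of a tree decomposition is $\max_i|X_i|-1$. The tree-width $tw(\Gamma)$ is the minimum width among all possible tree decompositions of $\Gamma$. **Contraction-width.** A tensor network is a (multi)graph in which each vertex $v$ carries a tensor whose legs are in bijection with the ends of the edges incident to $v$ (the two ends of each edge correspond to two different legs, of one or two tensors, having the same dimension). If legs of a tensor $T$ and legs of a tensor $T'$ are associated with the two ends of edges $e_1,\dots,e_s$ respectively, one can contract $T$ and $T'$ along $e_1,\dots,e_s$ at once, i.e. multiply the entries and sum over the common indices of the paired legs. In the graph, the edges $e_1,\dots,e_s$ are removed and the two vertices are replaced by one new vertex carrying the resulting tensor, whose legs are the remaining legs of $T$ and $T'$. Contractions of more than two tensors at once are defined similarly. A contraction sequence on a tensor network is a sequence of such contractions carried out until only one vertex remains; it can be encoded by the ordered list of sets of edges removed at each step. For a step that contracts $c$ tensors with $l_1,\dots,l_c$ legs respectively along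 $s$ edges at once, its local contraction-width is $-s+\sum_{i=1}^c l_i$. The contraction-width $w(\mathcal S)$ of a contraction sequence $\mathcal S$ is the maximum local contraction-width of all its steps, and the contraction-width $w(\Gamma)$ of $\Gamma$ is the minimal contraction-width among all possible contraction sequences on $\Gamma$. These notions do not depend on the dimensions of the legs or the entries of the tensors, so (abstract) contraction sequences on a graph $\Gamma$, and its contraction-width $w(\Gamma)$, are defined in the same way. *)

theory Defs
  imports Main "HOL-Library.Multiset"
begin

text \<open>Finite undirected multigraphs, loops and parallel edges allowed. The two ends of an edge form
  a multiset of size two, so that a loop at \<open>v\<close> has the ends \<open>{#v, v#}\<close>.\<close>

record ('v, 'e) multigraph =
  verts :: "'v set"
  edges :: "'e set"
  ends :: "'e \<Rightarrow> 'v multiset"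

definition is_graph :: "('v, 'e) multigraph \<Rightarrow> bool" where
  "is_graph G \<longleftrightarrow> finite (verts G) \<and> verts G \<noteq> {} \<and> finite (edges G) \<and>
     (\<forall>e\<in>edges G. size (ends G e) = 2 \<and> set_mset (ends G e) \<subseteq> verts G)"

text \<open>The degree counts ends of edges, i.e. the legs of the tensor at \<open>v\<close>; a loop counts twice.\<close>

definition degree :: "('v, 'e) multigraph \<Rightarrow> 'v \<Rightarrow> nat" where
  "degree G v = (\<Sum>e\<in>edges G. count (ends G e) v)"

definition max_degree :: "('v, 'e) multigraph \<Rightarrow> nat" where
  "max_degree G = Max (degree G ` verts G)"


section \<open>Tree-width\<close>

definition is_path :: "'i set set \<Rightarrow> 'i \<Rightarrow> 'i list \<Rightarrow> 'i \<Rightarrow> bool" where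
  "is_path F i p j \<longleftrightarrow>
     p \<noteq> [] \<and> hd p = i \<and> last p = j \<and> distinct p \<and> successively (\<lambda>x y. {x, y} \<in> F) p"

definition is_tree :: "'i set \<Rightarrow> 'i set set \<Rightarrow> bool" where
  "is_tree I F \<longleftrightarrow> finite I \<and> I \<noteq> {} \<and>
     (\<forall>f\<in>F. \<exists>i\<in>I. \<exists>j\<in>I. i \<noteq> j \<and> f = {i, j}) \<and>
     (\<forall>i\<in>I. \<forall>j\<in>I. \<exists>!p. is_path F i p j)"

text \<open>A bag \<open>X i\<close> is attached to each node \<open>i\<close> of the tree with node set \<open>I\<close> and edge set \<open>F\<close>.
  Since the tree is finite, natural numbers suffice as names of its nodes.\<close>

definition tree_decomposition ::
    "('v, 'e) multigraph \<Rightarrow> nat set \<Rightarrow> nat set set \<Rightarrow> (nat \<Rightarrow> 'v set) \<Rightarrow> bool" where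
  "tree_decomposition G I F X \<longleftrightarrow> is_tree I F \<and>
     (\<Union>i\<in>I. X i) = verts G \<and>
     (\<forall>i\<in>I. \<forall>j\<in>I. \<forall>p. is_path F i p j \<longrightarrow> (\<forall>k\<in>set p. X i \<inter> X j \<subseteq> X k)) \<and>
     (\<forall>e\<in>edges G. \<exists>i\<in>I. set_mset (ends G e) \<subseteq> X i)"

text \<open>The subtraction does not truncate: the bags cover the nonempty vertex set.\<close>

definition decomposition_width :: "nat set \<Rightarrow> (nat \<Rightarrow> 'v set) \<Rightarrow> nat" where
  "decomposition_width I X = Max ((\<lambda>i. card (X i)) ` I) - 1"

definition treewidth :: "('v, 'e) multigraph \<Rightarrow> nat" where
  "treewidth G = (LEAST k. \<exists>I F X. tree_decomposition G I F X \<and> decomposition_width I X = k)"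


section \<open>Contraction-width\<close>

definition reach :: "('v, 'e) multigraph \<Rightarrow> 'e set \<Rightarrow> ('v \<times> 'v) set" where
  "reach G S = {(u, v). \<exists>e\<in>S. ends G e = {#u, v#}}\<^sup>*"

text \<open>A step contracts the tensors at the vertices in \<open>C\<close> along the edges in \<open>S\<close>. The edges in \<open>S\<close>
  need not be all edges with both ends in \<open>C\<close>; those left over become loops. A single tensor can be
  contracted with itself along loops.

  The contracted tensors have to be linked by the contracted edges, so that in a connected graph a
  step is determined by \<open>S\<close>. Only tensors in different connected components, which no edges can
  link, may be multiplied without summation. Without this a disconnected graph would have no
  contraction sequence.\<close>

definition contraction_step :: "('v, 'e) multigraph \<Rightarrow> 'v set \<Rightarrow> 'e set \<Rightarrow> bool" where
  "contraction_step G C S \<longleftrightarrow> C \<subseteq> verts G \<and> S \<subseteq> edges G \<and>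
     (\<forall>e\<in>S. set_mset (ends G e) \<subseteq> C) \<and>
     (\<forall>u\<in>C. \<forall>v\<in>C. (u, v) \<in> reach G (edges G) \<longrightarrow> (u, v) \<in> reach G S) \<and>
     (card C \<ge> 2 \<or> S \<noteq> {})"

text \<open>The new vertex is named after one of the vertices it replaces.\<close>

definition contract :: "('v, 'e) multigraph \<Rightarrow> 'v set \<Rightarrow> 'e set \<Rightarrow> ('v, 'e) multigraph" where
  "contract G C S = (let u = (SOME u. u \<in> C) in
     \<lparr>verts = insert u (verts G - C),
      edges = edges G - S,
      ends = (\<lambda>e. image_mset (\<lambda>v. if v \<in> C then u else v) (ends G e))\<rparr>)"

text \<open>The subtraction does not truncate: both ends of each edge in \<open>S\<close> are legs of tensors in
  \<open>C\<close>.\<close>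

definition local_contraction_width :: "('v, 'e) multigraph \<Rightarrow> 'v set \<Rightarrow> 'e set \<Rightarrow> nat" where
  "local_contraction_width G C S = (\<Sum>v\<in>C. degree G v) - card S"

fun contraction_sequence :: "('v, 'e) multigraph \<Rightarrow> ('v set \<times> 'e set) list \<Rightarrow> bool" where
  "contraction_sequence G [] \<longleftrightarrow> card (verts G) = 1"
| "contraction_sequence G ((C, S) # steps) \<longleftrightarrow>
     contraction_step G C S \<and> contraction_sequence (contract G C S) steps"

text \<open>The empty sequence, possible for a one-vertex graph, has width 0.\<close>

fun sequence_width :: "('v, 'e) multigraph \<Rightarrow> ('v set \<times> 'e set) list \<Rightarrow> nat" where
  "sequence_width G [] = 0"
| "sequence_width G ((C, S) # steps) =
     max (local_contraction_width G C S) (sequence_width (contract G C S) steps)"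

definition contraction_width :: "('v, 'e) multigraph \<Rightarrow> nat" where
  "contraction_width G =
     (LEAST k. \<exists>steps. contraction_sequence G steps \<and> sequence_width G steps = k)"


section \<open>The minima range over nonempty sets\<close>

lemma tree_decomposition_exists:
  assumes "is_graph G"
  shows "\<exists>I F X. tree_decomposition G I F X"
proof -
  have *: "is_path {} 0 p 0 \<longleftrightarrow> p = [0]" for p :: "nat list"
    by (cases p rule: remdups_adj.cases) (auto simp: is_path_def)
  have "is_tree {0::nat} {}"
    by (simp add: is_tree_def *)
  then have "tree_decomposition G {0} {} (\<lambda>_. verts G)"
    using assms by (auto simp: tree_decomposition_def is_graph_def)
  then show ?thesis by blast
qed

lemma contraction_sequence_exists:
  assumes "is_graph G"
  shows "\<exists>steps. contraction_sequence G steps"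
proof (cases "card (verts G) = 1")
  case True
  then have "contraction_sequence G []" by simp
  then show ?thesis by blast
next
  case False
  with assms have "card (verts G) \<ge> 2"
    by (metis One_nat_def Suc_1 card_0_eq is_graph_def less_Suc_eq_le linorder_not_le nat_less_le
        not_less_eq_eq less_one)
  with assms have "contraction_step G (verts G) (edges G)"
    by (auto simp: contraction_step_def is_graph_def)
  then have "contraction_sequence G [(verts G, edges G)]"
    by (simp add: contract_def Let_def)
  then show ?thesis by blast
qed

end

theory Submission imports Defs begin

text \<open>
  Call an edge incident to a bag if one of its ends lies in the bag. Replacing each bag \<open>X i\<close> of an
  optimal tree decomposition by the set \<open>Y i\<close> of edges incident to it gives a tree decomposition
  of the line graph: the edges at any one vertex lie in a common \<open>Y i\<close>, and the nodes whose bags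
  contain a given edge form a subtree. Moreover \<open>Y i\<close> has at most
  \<open>max_degree G * card (X i)\<close> elements.

  Such a family \<open>Y\<close> yields a contraction sequence all of whose steps have local width at most the
  size of some \<open>Y i\<close>. Root the tree, and pick the edge \<open>e\<close> whose subtree has its topmost node \<open>t\<close> as
  deep as possible. All edges that share a vertex with \<open>e\<close> then belong to \<open>Y t\<close>
  (\<open>edge_with_neighbours_in_one_bag\<close>). Contract the ends of \<open>e\<close> along all edges between them. When
  a set of tensors is contracted along all edges inside it, the local width counts each edge at one
  of these tensors only once, so here it is at most \<open>card (Y t)\<close>. The edges at the new vertex again
  lie in \<open>Y t\<close>, hence the same \<open>Y\<close> serves for the contracted graph and the argument can be repeated
  until no edge is left (\<open>contraction_sequence_from_edge_bags\<close>). If several tensors remain, they have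
  no legs and are multiplied in a single step of width 0.
\<close>

section \<open>Rooted trees\<close>

lemma is_path_unique:
  assumes "is_tree I F" "i \<in> I" "j \<in> I" "is_path F i p j" "is_path F i q j"
  shows "p = q"
  using assms unfolding is_tree_def by blast

lemma is_path_prefix:
  assumes "is_path F i (xs @ x # ys) j"
  shows "is_path F i (xs @ [x]) x"
proof -
  have "successively (\<lambda>x y. {x, y} \<in> F) ((xs @ [x]) @ ys)" using assms by (simp add: is_path_def)
  then have "successively (\<lambda>x y. {x, y} \<in> F) (xs @ [x])"
    unfolding successively_append_iff[of _ "xs @ [x]"] by blast
  with assms show ?thesis by (cases xs) (simp_all add: is_path_def)
qed

text \<open>Rooting the tree turns the condition on paths into one that refers to depth only: from a
  node to any other node that is not deeper, one has to go through the parent. At the root there is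
  no such other node, so its parent need not be specified.\<close>

lemma tree_parent_on_paths:
  assumes tree: "is_tree I F"
  obtains d :: "'i \<Rightarrow> nat" and par :: "'i \<Rightarrow> 'i" where
    "\<And>l j. l \<in> I \<Longrightarrow> j \<in> I \<Longrightarrow> j \<noteq> l \<Longrightarrow> d j \<le> d l \<Longrightarrow>
       par l \<in> I \<and> d (par l) < d l \<and> (\<exists>p. is_path F l p j \<and> par l \<in> set p)"
proof -
  obtain r where r: "r \<in> I" using tree by (auto simp: is_tree_def)
  define P where "P i = (THE p. is_path F r p i)" for i
  have P: "is_path F r (P i) i" if "i \<in> I" for i
  proof -
    have "\<exists>!p. is_path F r p i" using tree r that by (simp add: is_tree_def)
    then show ?thesis unfolding P_def by (rule theI')
  qed
  have P_eq: "P i = p" if "i \<in> I" "is_path F r p i" for i p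
    using is_path_unique[OF tree r that(1) P[OF that(1)] that(2)] .
  define d where "d i = length (P i)" for i
  define par where "par i = last (butlast (P i))" for i
  have "par l \<in> I \<and> d (par l) < d l \<and> (\<exists>p. is_path F l p j \<and> par l \<in> set p)"
    if l: "l \<in> I" and j: "j \<in> I" and "j \<noteq> l" and le: "d j \<le> d l" for l j
  proof -
    \<comment> \<open>Otherwise \<open>P l\<close> would be a prefix of \<open>P j\<close>, and a proper one because \<open>j \<noteq> l\<close>.\<close>
    have l_notin: "l \<notin> set (P j)"
    proof
      assume "l \<in> set (P j)"
      then obtain xs ys where s: "P j = xs @ l # ys" by (meson split_list)
      have "P l = xs @ [l]"
        using P_eq[OF l] is_path_prefix[of F r xs l ys j] P[OF j] s by simp
      with le s have "ys = []" by (simp add: d_def)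
      with s P[OF j] \<open>j \<noteq> l\<close> show False by (simp add: is_path_def)
    qed
    have rj: "r \<in> set (P j)" using P[OF j] by (auto simp: is_path_def)
    with l_notin have "l \<noteq> r" by auto
    define q where "q = butlast (butlast (P l))"
    have Pl: "P l = q @ [par l, l]"
    proof -
      have 1: "P l = butlast (P l) @ [l]"
        using P[OF l] append_butlast_last_id[of "P l"] by (simp add: is_path_def)
      have "butlast (P l) \<noteq> []"
      proof
        assume "butlast (P l) = []"
        with 1 have "P l = [l]" by simp
        with P[OF l] \<open>l \<noteq> r\<close> show False by (simp add: is_path_def)
      qed
      then have "butlast (P l) = q @ [par l]" by (simp add: q_def par_def)
      with 1 show ?thesis by simp
    qed
    have edge: "{par l, l} \<in> F"
      using P[OF l] unfolding Pl by (auto simp: is_path_def successively_append_iff)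
    then have par: "par l \<in> I" using tree by (auto simp: is_tree_def doubleton_eq_iff)
    have "is_path F r (q @ [par l]) (par l)"
      using P[OF l] is_path_prefix[of F r q "par l" "[l]" l] by (simp add: Pl)
    from P_eq[OF par this] have Pp: "P (par l) = q @ [par l]" .
    have "r \<in> set (P (par l))" using P[OF par] by (auto simp: is_path_def)
    \<comment> \<open>Climb from \<open>par l\<close> to the first vertex \<open>x\<close> on the path from the root to \<open>j\<close>, then descend
        along that path.\<close>
    then obtain a x b where ab: "P (par l) = a @ x # b" "x \<in> set (P j)"
      "\<forall>y\<in>set b. y \<notin> set (P j)"
      using split_list_last_prop[of "P (par l)" "\<lambda>y. y \<in> set (P j)"] rj by blast
    obtain a' b' where j_split: "P j = a' @ x # b'" using ab(2) by (meson split_list)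
    let ?p = "l # rev b @ x # b'"
    have Pl': "P l = a @ x # b @ [l]" using Pl Pp ab(1) by simp
    have "last (a @ x # b) = par l" using Pp ab(1) by simp
    then have last: "last (x # b) = par l" by simp
    have "successively (\<lambda>x y. {x, y} \<in> F) (x # b @ [l])"
      using P[OF l] unfolding Pl' by (auto simp: is_path_def successively_append_iff)
    then have "successively (\<lambda>x y. {x, y} \<in> F) (rev (x # b @ [l]))"
      unfolding successively_rev by (simp add: insert_commute)
    moreover have "successively (\<lambda>x y. {x, y} \<in> F) (x # b')"
      using P[OF j] unfolding j_split by (auto simp: is_path_def successively_append_iff)
    ultimately have "successively (\<lambda>x y. {x, y} \<in> F) ((l # rev b) @ x # b')"
      by (auto simp: successively_append_iff successively_Cons hd_append)
    moreover have "distinct ?p"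
      using P[OF l] P[OF j] ab(3) l_notin unfolding is_path_def Pl' j_split by auto
    moreover have "last ?p = j" using P[OF j] by (simp add: is_path_def j_split)
    ultimately have "is_path F l ?p j" by (simp add: is_path_def)
    moreover have "par l \<in> set ?p" using last last_in_set[of "x # b"] by auto
    moreover have "d (par l) < d l" by (simp add: d_def Pl Pp)
    ultimately show ?thesis using par by blast
  qed
  then show ?thesis by (rule that)
qed


section \<open>Families of bags on a rooted tree\<close>

text \<open>The rooted form of the condition that the nodes whose bags contain a given element form a
  subtree. The vertex bags and the edge bags both have it, over the same \<open>d\<close> and \<open>par\<close>.\<close>

definition rooted_bags :: "'i set \<Rightarrow> ('i \<Rightarrow> nat) \<Rightarrow> ('i \<Rightarrow> 'i) \<Rightarrow> ('i \<Rightarrow> 'a set) \<Rightarrow> bool" where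
  "rooted_bags I d par Z \<longleftrightarrow> (\<forall>l\<in>I. \<forall>j\<in>I. j \<noteq> l \<longrightarrow> d j \<le> d l \<longrightarrow>
     par l \<in> I \<and> d (par l) < d l \<and> Z l \<inter> Z j \<subseteq> Z (par l))"

lemma rooted_bagsD:
  assumes "rooted_bags I d par Z" "l \<in> I" "j \<in> I" "j \<noteq> l" "d j \<le> d l"
  shows "par l \<in> I" "d (par l) < d l" "\<And>x. x \<in> Z l \<Longrightarrow> x \<in> Z j \<Longrightarrow> x \<in> Z (par l)"
  using assms unfolding rooted_bags_def by blast+

lemma tree_decomposition_rooted_bags:
  assumes "tree_decomposition G I F X"
  obtains d par where "rooted_bags I d par X"
proof -
  have "is_tree I F" using assms by (simp add: tree_decomposition_def)
  then obtain d :: "nat \<Rightarrow> nat" and par where *: "\<And>l j. l \<in> I \<Longrightarrow> j \<in> I \<Longrightarrow> j \<noteq> l \<Longrightarrow> d j \<le> d l \<Longrightarrow>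
       par l \<in> I \<and> d (par l) < d l \<and> (\<exists>p. is_path F l p j \<and> par l \<in> set p)"
    by (rule tree_parent_on_paths) blast
  have "rooted_bags I d par X"
    unfolding rooted_bags_def
  proof (intro ballI impI)
    fix l j assume A: "l \<in> I" "j \<in> I" "j \<noteq> l" "d j \<le> d l"
    from *[OF this] obtain p where "is_path F l p j" "par l \<in> set p" by blast
    then have "X l \<inter> X j \<subseteq> X (par l)"
      using assms A(1,2) unfolding tree_decomposition_def by blast
    with *[OF A] show "par l \<in> I \<and> d (par l) < d l \<and> X l \<inter> X j \<subseteq> X (par l)" by blast
  qed
  then show ?thesis by (rule that)
qed

text \<open>The subtrees of the vertices of an edge pairwise share a node, so their union is a subtree too.
  In detail, let \<open>u\<close> lie in the bag of \<open>l\<close> and \<open>v\<close> in the bag of a node \<open>j\<close> that is not deeper, and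
  choose a node \<open>m\<close> shared by \<open>u\<close> and \<open>v\<close> as high as possible. If \<open>m\<close> were deeper than \<open>l\<close>, then
  both vertices would persist in the bag of the parent of \<open>m\<close>. So \<open>m\<close> is not deeper than \<open>l\<close>, and
  \<open>u\<close> persists from \<open>l\<close> to its parent, or \<open>v\<close> does if \<open>m = l\<close>.\<close>

lemma rooted_bags_hitting:
  assumes X: "rooted_bags I d par X"
    and cover: "\<And>e. e \<in> E \<Longrightarrow> \<exists>i\<in>I. A e \<subseteq> X i"
  shows "rooted_bags I d par (\<lambda>i. {e \<in> E. A e \<inter> X i \<noteq> {}})"
  unfolding rooted_bags_def
proof (intro ballI impI conjI subsetI)
  fix l j assume lj: "l \<in> I" "j \<in> I" "j \<noteq> l" "d j \<le> d l"
  show "par l \<in> I" "d (par l) < d l" using rooted_bagsD[OF X lj] by auto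
  fix e assume "e \<in> {e \<in> E. A e \<inter> X l \<noteq> {}} \<inter> {e \<in> E. A e \<inter> X j \<noteq> {}}"
  then obtain u v where e: "e \<in> E" and uv: "u \<in> A e" "v \<in> A e" "u \<in> X l" "v \<in> X j" by blast
  have "\<exists>m. m \<in> I \<and> u \<in> X m \<and> v \<in> X m" using cover[OF e] uv by blast
  then obtain m where m: "m \<in> I" "u \<in> X m" "v \<in> X m"
    and min: "\<And>m'. m' \<in> I \<Longrightarrow> u \<in> X m' \<Longrightarrow> v \<in> X m' \<Longrightarrow> d m \<le> d m'"
    using ex_has_least_nat[of "\<lambda>m. m \<in> I \<and> u \<in> X m \<and> v \<in> X m" _ d] by blast
  have "d m \<le> d l"
  proof (rule ccontr)
    assume "\<not> d m \<le> d l"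
    then have lm: "l \<noteq> m" "d l \<le> d m" and jm: "j \<noteq> m" "d j \<le> d m" using lj by auto
    note up_l = rooted_bagsD[OF X m(1) lj(1) lm] and up_j = rooted_bagsD[OF X m(1) lj(2) jm]
    have "d m \<le> d (par m)"
      by (rule min[OF up_l(1) up_l(3)[OF m(2) uv(3)] up_j(3)[OF m(3) uv(4)]])
    with up_l(2) show False by simp
  qed
  have "u \<in> X (par l) \<or> v \<in> X (par l)"
  proof (cases "m = l")
    case True
    with m(3) uv(4) rooted_bagsD(3)[OF X lj] show ?thesis by blast
  next
    case False
    with rooted_bagsD(3)[OF X lj(1) m(1) False \<open>d m \<le> d l\<close>] m(2) uv(3) show ?thesis by blast
  qed
  with e uv show "e \<in> {e \<in> E. A e \<inter> X (par l) \<noteq> {}}" by blast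
qed

text \<open>This is the existence of a simplicial vertex in a chordal graph. Let \<open>e\<close> be an element whose
  topmost node \<open>t\<close> is as deep as possible. Every \<open>f\<close> that shares some bag with \<open>e\<close> then has a topmost
  node not deeper than \<open>t\<close>, so on the way up from that bag to \<open>t\<close> neither \<open>e\<close> nor \<open>f\<close> gets lost.\<close>

lemma simplicial_element:
  assumes Y: "rooted_bags I d par Y"
    and R: "finite R" "R \<noteq> {}" "\<And>f. f \<in> R \<Longrightarrow> \<exists>i\<in>I. f \<in> Y i"
  obtains e t where "e \<in> R" "t \<in> I"
    "\<And>i f. i \<in> I \<Longrightarrow> e \<in> Y i \<Longrightarrow> f \<in> R \<Longrightarrow> f \<in> Y i \<Longrightarrow> f \<in> Y t"
proof -
  have "\<exists>i. (i \<in> I \<and> f \<in> Y i) \<and> (\<forall>i'. i' \<in> I \<and> f \<in> Y i' \<longrightarrow> d i \<le> d i')" if "f \<in> R" for f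
    using R(3)[OF that] ex_has_least_nat[of "\<lambda>i. i \<in> I \<and> f \<in> Y i" _ d] by blast
  then obtain top where top: "\<And>f. f \<in> R \<Longrightarrow> top f \<in> I" "\<And>f. f \<in> R \<Longrightarrow> f \<in> Y (top f)"
    and min: "\<And>f i. f \<in> R \<Longrightarrow> i \<in> I \<Longrightarrow> f \<in> Y i \<Longrightarrow> d (top f) \<le> d i"
    by metis
  have "Max ((d \<circ> top) ` R) \<in> (d \<circ> top) ` R" using R by simp
  then obtain e where e: "e \<in> R" "d (top e) = Max ((d \<circ> top) ` R)" by auto
  have max: "d (top f) \<le> d (top e)" if "f \<in> R" for f
    using e(2) R(1) that by simp
  have "f \<in> Y (top e)" if f: "f \<in> R" and "i \<in> I" "e \<in> Y i" "f \<in> Y i" for i f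
    using that(2-)
  proof (induction "d i" arbitrary: i rule: less_induct)
    case less
    show ?case
    proof (cases "i = top e")
      case False
      have le: "d (top e) \<le> d i" using min[OF e(1)] less.prems by blast
      note up = rooted_bagsD[OF Y less.prems(1) top(1)[OF e(1)] False[symmetric] le]
      have eY: "e \<in> Y (par i)" by (rule up(3)[OF less.prems(2) top(2)[OF e(1)]])
      have "d (top e) \<le> d (par i)" by (rule min[OF e(1) up(1) eY])
      with up(2) max[OF f] have lt: "d (top f) < d i" by linarith
      then have "top f \<noteq> i" by auto
      from rooted_bagsD(3)[OF Y less.prems(1) top(1)[OF f] this] lt
      have "f \<in> Y (par i)" using less.prems(3) top(2)[OF f] by simp
      with less.hyps[OF up(2) up(1) eY] show ?thesis .
    qed (use less.prems in simp)
  qed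
  with e(1) top(1) show ?thesis using that by blast
qed


section \<open>Contracting along an edge\<close>

definition incident_edges :: "('v, 'e) multigraph \<Rightarrow> 'v set \<Rightarrow> 'e set" where
  "incident_edges G C = {e \<in> edges G. set_mset (ends G e) \<inter> C \<noteq> {}}"

definition inner_edges :: "('v, 'e) multigraph \<Rightarrow> 'v set \<Rightarrow> 'e set" where
  "inner_edges G C = {e \<in> edges G. set_mset (ends G e) \<subseteq> C}"

lemma sum_count_le_size:
  assumes "finite C"
  shows "(\<Sum>v\<in>C. count M v) \<le> size M"
proof -
  have "(\<Sum>v\<in>C. count M v) = (\<Sum>v\<in>C \<inter> set_mset M. count M v)"
    using assms by (intro sum.mono_neutral_right) (auto simp: not_in_iff)
  also have "\<dots> \<le> (\<Sum>v\<in>set_mset M. count M v)" by (rule sum_mono2) auto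
  finally show ?thesis by (simp add: size_multiset_overloaded_eq)
qed

text \<open>An edge with a single end in \<open>C\<close> contributes one leg, and an edge inside \<open>C\<close> contributes two
  legs, one of which is subtracted again.\<close>

lemma local_contraction_width_inner_edges:
  assumes G: "is_graph G" and C: "finite C"
  shows "local_contraction_width G C (inner_edges G C) \<le> card (incident_edges G C)"
proof -
  have fin: "finite (edges G)" using G by (simp add: is_graph_def)
  have "(\<Sum>v\<in>C. degree G v) = (\<Sum>e\<in>edges G. \<Sum>v\<in>C. count (ends G e) v)"
    unfolding degree_def by (rule sum.swap)
  also have "\<dots> \<le> (\<Sum>e\<in>edges G. of_bool (e \<in> incident_edges G C) + of_bool (e \<in> inner_edges G C))"
  proof (rule sum_mono)
    fix e assume e: "e \<in> edges G"
    then have size: "size (ends G e) = 2" using G by (simp add: is_graph_def)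
    have le2: "(\<Sum>v\<in>C. count (ends G e) v) \<le> 2"
      using sum_count_le_size[OF C, of "ends G e"] size by simp
    consider "e \<in> inner_edges G C" | "e \<notin> incident_edges G C"
      | "e \<in> incident_edges G C" "e \<notin> inner_edges G C" by blast
    then show "(\<Sum>v\<in>C. count (ends G e) v)
        \<le> of_bool (e \<in> incident_edges G C) + of_bool (e \<in> inner_edges G C)"
    proof cases
      case 1
      then have "e \<in> incident_edges G C"
        using size by (auto simp: inner_edges_def incident_edges_def Int_absorb2)
      with 1 le2 show ?thesis by simp
    next
      case 2
      then have "\<forall>v\<in>C. count (ends G e) v = 0"
        using e by (auto simp: incident_edges_def not_in_iff[symmetric])
      then show ?thesis by simp
    next
      case 3
      then obtain x where x: "x \<in># ends G e" "x \<notin> C" using e by (auto simp: inner_edges_def)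
      have "(\<Sum>v\<in>insert x C. count (ends G e) v) \<le> 2"
        using sum_count_le_size[of "insert x C" "ends G e"] C size by simp
      then have "count (ends G e) x + (\<Sum>v\<in>C. count (ends G e) v) \<le> 2" using x(2) C by simp
      moreover have "count (ends G e) x \<ge> 1"
        using x(1) unfolding count_greater_eq_one_iff .
      ultimately have "(\<Sum>v\<in>C. count (ends G e) v) \<le> 1" by linarith
      with 3 show ?thesis by simp
    qed
  qed
  also have "\<dots> = card (incident_edges G C) + card (inner_edges G C)"
  proof -
    have "incident_edges G C \<subseteq> edges G" "inner_edges G C \<subseteq> edges G"
      by (auto simp: incident_edges_def inner_edges_def)
    with fin show ?thesis by (simp add: sum.distrib sum_of_bool_eq Int_absorb1 Int_absorb2)
  qed
  finally show ?thesis by (simp add: local_contraction_width_def)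
qed

lemma contraction_step_ends:
  assumes "is_graph G" "e \<in> edges G"
  shows "contraction_step G (set_mset (ends G e)) (inner_edges G (set_mset (ends G e)))"
proof -
  let ?S = "inner_edges G (set_mset (ends G e))"
  have e: "e \<in> ?S" using assms(2) by (simp add: inner_edges_def)
  have size: "size (ends G e) = Suc 1" using assms by (simp add: is_graph_def)
  then obtain a M where M: "ends G e = add_mset a M" using size_eq_Suc_imp_eq_union by blast
  with size have "size M = 1" by simp
  then obtain b where "M = {#b#}" using size_1_singleton_mset by blast
  with M have ab: "ends G e = {#a, b#}" by simp
  have "(u, v) \<in> reach G ?S" if "u \<in># ends G e" "v \<in># ends G e" for u v
  proof (cases "u = v")
    case False
    with that ab have "ends G e = {#u, v#}" by (auto simp: add_mset_commute)
    with e show ?thesis unfolding reach_def by blast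
  qed (simp add: reach_def)
  moreover have "set_mset (ends G e) \<subseteq> verts G" using assms by (simp add: is_graph_def)
  ultimately show ?thesis using e unfolding contraction_step_def
    by (auto simp: inner_edges_def)
qed

lemma contract_cases:
  assumes "C \<noteq> {}"
  obtains u where "u \<in> C" "contract G C S = \<lparr>verts = insert u (verts G - C), edges = edges G - S,
      ends = (\<lambda>e. image_mset (\<lambda>v. if v \<in> C then u else v) (ends G e))\<rparr>"
  using that[of "SOME u. u \<in> C"] assms by (simp add: some_in_eq contract_def Let_def)

lemma is_graph_contract:
  assumes "is_graph G" "C \<noteq> {}"
  shows "is_graph (contract G C S)"
proof -
  obtain u where c: "contract G C S =
      \<lparr>verts = insert u (verts G - C), edges = edges G - S,
       ends = (\<lambda>e. image_mset (\<lambda>v. if v \<in> C then u else v) (ends G e))\<rparr>"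
    using contract_cases[OF assms(2)] .
  have "set_mset (ends (contract G C S) e) \<subseteq> verts (contract G C S)" if "e \<in> edges G" for e
    using assms(1) that unfolding is_graph_def c by fastforce
  with assms(1) show ?thesis unfolding is_graph_def by (simp add: c)
qed

text \<open>The new vertex inherits its edges from the vertices it replaces, and every other vertex keeps
  its own.\<close>

lemma incident_edges_contract:
  assumes "C \<noteq> {}" "w \<in> verts (contract G C S)"
  shows "incident_edges (contract G C S) {w} \<subseteq> incident_edges G C \<or>
    w \<in> verts G \<and> incident_edges (contract G C S) {w} \<subseteq> incident_edges G {w}"
proof -
  obtain u where u: "u \<in> C" and c: "contract G C S =
      \<lparr>verts = insert u (verts G - C), edges = edges G - S,
       ends = (\<lambda>e. image_mset (\<lambda>v. if v \<in> C then u else v) (ends G e))\<rparr>"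
    using contract_cases[OF assms(1)] .
  show ?thesis
  proof (cases "w = u")
    case True
    then have "incident_edges (contract G C S) {w} \<subseteq> incident_edges G C"
      using u by (auto simp: incident_edges_def c split: if_splits)
    then show ?thesis ..
  next
    case False
    then have "incident_edges (contract G C S) {w} \<subseteq> incident_edges G {w}"
      by (auto simp: incident_edges_def c split: if_splits)
    with False assms(2) show ?thesis by (simp add: c)
  qed
qed


section \<open>From edge bags to a contraction sequence\<close>

lemma edge_with_neighbours_in_one_bag:
  assumes G: "is_graph G" "edges G \<noteq> {}" and Y: "rooted_bags I d par Y"
    and cover: "\<And>v. v \<in> verts G \<Longrightarrow> \<exists>i\<in>I. incident_edges G {v} \<subseteq> Y i"
  obtains e t where "e \<in> edges G" "t \<in> I" "incident_edges G (set_mset (ends G e)) \<subseteq> Y t"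
proof -
  have inc: "\<exists>i\<in>I. incident_edges G {v} \<subseteq> Y i" if "e \<in> edges G" "v \<in># ends G e" for e v
    using G(1) that cover by (auto simp: is_graph_def)
  have "\<exists>i\<in>I. f \<in> Y i" if f: "f \<in> edges G" for f
  proof -
    have "ends G f \<noteq> {#}" using G(1) f by (auto simp: is_graph_def)
    then obtain v where v: "v \<in># ends G f" by (meson multiset_nonemptyE)
    from inc[OF f v] f v show ?thesis by (auto simp: incident_edges_def)
  qed
  moreover have "finite (edges G)" using G(1) by (simp add: is_graph_def)
  ultimately obtain e t where e: "e \<in> edges G" "t \<in> I"
    and simplicial: "\<And>i f. i \<in> I \<Longrightarrow> e \<in> Y i \<Longrightarrow> f \<in> edges G \<Longrightarrow> f \<in> Y i \<Longrightarrow> f \<in> Y t"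
    using simplicial_element[OF Y _ G(2)] by metis
  have "incident_edges G (set_mset (ends G e)) \<subseteq> Y t"
  proof
    fix f assume "f \<in> incident_edges G (set_mset (ends G e))"
    then obtain v where f: "f \<in> edges G" and v: "v \<in># ends G f" "v \<in># ends G e"
      by (auto simp: incident_edges_def)
    from inc[OF e(1) v(2)] obtain i where i: "i \<in> I" "incident_edges G {v} \<subseteq> Y i" by blast
    have "e \<in> Y i" "f \<in> Y i" using i(2) e(1) f v by (auto simp: incident_edges_def)
    with simplicial i(1) f show "f \<in> Y t" by blast
  qed
  with e show ?thesis by (rule that)
qed

lemma contraction_sequence_no_edges:
  assumes G: "is_graph G" and no_edges: "edges G = {}"
  shows "\<exists>steps. contraction_sequence G steps \<and> sequence_width G steps = 0"
proof (cases "card (verts G) = 1")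
  case True
  then have "contraction_sequence G [] \<and> sequence_width G [] = 0" by simp
  then show ?thesis by blast
next
  case False
  moreover have "card (verts G) > 0" using G by (simp add: is_graph_def card_gt_0_iff)
  ultimately have "card (verts G) \<ge> 2" by linarith
  with no_edges have "contraction_step G (verts G) {}" by (simp add: contraction_step_def)
  then have "contraction_sequence G [(verts G, {})] \<and> sequence_width G [(verts G, {})] = 0"
    using no_edges
    by (simp add: contract_def Let_def local_contraction_width_def degree_def)
  then show ?thesis by blast
qed

text \<open>The hypothesis on vertices is the form in which the decomposition survives contractions: the
  bags stay the same, although they may come to contain edges that are already gone.\<close>

lemma contraction_sequence_from_edge_bags:
  assumes "rooted_bags I d par Y" "\<And>i. i \<in> I \<Longrightarrow> finite (Y i) \<and> card (Y i) \<le> w"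
    and "is_graph G" "\<And>v. v \<in> verts G \<Longrightarrow> \<exists>i\<in>I. incident_edges G {v} \<subseteq> Y i"
  shows "\<exists>steps. contraction_sequence G steps \<and> sequence_width G steps \<le> w"
  using assms(3,4)
proof (induction "card (edges G)" arbitrary: G rule: less_induct)
  case less
  show ?case
  proof (cases "edges G = {}")
    case True
    then show ?thesis using contraction_sequence_no_edges[OF less.prems(1)] by fastforce
  next
    case False
    obtain e t where e: "e \<in> edges G" "t \<in> I"
      and bag: "incident_edges G (set_mset (ends G e)) \<subseteq> Y t"
      using edge_with_neighbours_in_one_bag[OF less.prems(1) False assms(1) less.prems(2)] by blast
    define C where "C = set_mset (ends G e)"
    define S where "S = inner_edges G C"
    have eS: "e \<in> S" using e(1) by (simp add: S_def C_def inner_edges_def)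
    have "C \<noteq> {}" using less.prems(1) e(1) by (auto simp: C_def is_graph_def)
    have step: "contraction_step G C S"
      unfolding C_def S_def by (rule contraction_step_ends[OF less.prems(1) e(1)])
    have "local_contraction_width G C S \<le> card (incident_edges G C)"
      unfolding S_def using less.prems(1)
      by (rule local_contraction_width_inner_edges) (simp add: C_def)
    also have "\<dots> \<le> w"
      using assms(2)[OF e(2)] bag unfolding C_def by (meson card_mono le_trans)
    finally have width: "local_contraction_width G C S \<le> w" .
    have "edges (contract G C S) = edges G - S" by (simp add: contract_def Let_def)
    moreover have "edges G - S \<subset> edges G" using e(1) eS by blast
    moreover have "finite (edges G)" using less.prems(1) by (simp add: is_graph_def)
    ultimately have smaller: "card (edges (contract G C S)) < card (edges G)"
      by (simp add: psubset_card_mono)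
    have "\<exists>i\<in>I. incident_edges (contract G C S) {v} \<subseteq> Y i" if "v \<in> verts (contract G C S)" for v
      using incident_edges_contract[OF \<open>C \<noteq> {}\<close> that] less.prems(2)[of v] bag e(2)
      unfolding C_def by (meson subset_trans)
    with less.hyps[OF smaller is_graph_contract[OF less.prems(1) \<open>C \<noteq> {}\<close>]]
    obtain steps where "contraction_sequence (contract G C S) steps"
      "sequence_width (contract G C S) steps \<le> w" by blast
    with step width have "contraction_sequence G ((C, S) # steps) \<and>
        sequence_width G ((C, S) # steps) \<le> w" by simp
    then show ?thesis by blast
  qed
qed


section \<open>The bound on the contraction-width\<close>

lemma card_incident_edges_le:
  assumes G: "is_graph G" and C: "C \<subseteq> verts G"
  shows "card (incident_edges G C) \<le> max_degree G * card C"
proof -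
  have finV: "finite (verts G)" and finE: "finite (edges G)" using G by (auto simp: is_graph_def)
  have finC: "finite C" using C finV by (rule finite_subset)
  have "card (incident_edges G C) = (\<Sum>e\<in>edges G. of_bool (e \<in> incident_edges G C))"
  proof -
    have "incident_edges G C \<subseteq> edges G" by (auto simp: incident_edges_def)
    with finE show ?thesis by (simp add: sum_of_bool_eq Int_absorb1 Int_absorb2)
  qed
  also have "\<dots> \<le> (\<Sum>e\<in>edges G. \<Sum>v\<in>C. count (ends G e) v)"
  proof (rule sum_mono)
    fix e
    show "of_bool (e \<in> incident_edges G C) \<le> (\<Sum>v\<in>C. count (ends G e) v)"
    proof (cases "e \<in> incident_edges G C")
      case True
      then obtain v where v: "v \<in># ends G e" "v \<in> C" by (auto simp: incident_edges_def)
      then have "0 < (\<Sum>v\<in>C. count (ends G e) v)"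
        using finC by (intro sum_pos2[of C v]) auto
      with True show ?thesis by simp
    qed simp
  qed
  also have "\<dots> = (\<Sum>v\<in>C. degree G v)" unfolding degree_def by (rule sum.swap)
  also have "\<dots> \<le> (\<Sum>v\<in>C. max_degree G)"
    using finV C by (intro sum_mono) (auto simp: max_degree_def)
  finally show ?thesis by (simp add: mult.commute)
qed

theorem lemma1p3:
  fixes G :: "('v, 'e) multigraph"
  assumes "is_graph G"
  shows "contraction_width G \<le> max_degree G * (treewidth G + 1)"
proof -
  have "\<exists>k I F X. tree_decomposition G I F X \<and> decomposition_width I X = k"
    using tree_decomposition_exists[OF assms] by blast
  then have "\<exists>I F X. tree_decomposition G I F X \<and> decomposition_width I X = treewidth G"
    unfolding treewidth_def by (rule LeastI_ex)
  then obtain I F X where dec: "tree_decomposition G I F X"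
    and tw: "decomposition_width I X = treewidth G" by blast
  define Y where "Y = (\<lambda>i. incident_edges G (X i))"
  obtain d par where "rooted_bags I d par X" using tree_decomposition_rooted_bags[OF dec] .
  then have Y: "rooted_bags I d par Y"
    unfolding Y_def incident_edges_def
    by (rule rooted_bags_hitting) (use dec in \<open>auto simp: tree_decomposition_def\<close>)
  have size: "finite (Y i) \<and> card (Y i) \<le> max_degree G * (treewidth G + 1)" if i: "i \<in> I" for i
  proof
    show "finite (Y i)" using assms by (simp add: Y_def incident_edges_def is_graph_def)
    have "X i \<subseteq> verts G" using dec i by (auto simp: tree_decomposition_def)
    then have "card (Y i) \<le> max_degree G * card (X i)"
      unfolding Y_def by (rule card_incident_edges_le[OF assms])
    moreover have "card (X i) \<le> treewidth G + 1"
    proof -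
      have "finite I" using dec by (simp add: tree_decomposition_def is_tree_def)
      then have "card (X i) \<le> Max ((\<lambda>i. card (X i)) ` I)" using i by simp
      then show ?thesis by (simp add: tw[symmetric] decomposition_width_def)
    qed
    ultimately show "card (Y i) \<le> max_degree G * (treewidth G + 1)"
      by (meson le_trans mult_le_mono2)
  qed
  have "\<exists>i\<in>I. incident_edges G {v} \<subseteq> Y i" if "v \<in> verts G" for v
  proof -
    have "v \<in> (\<Union>i\<in>I. X i)" using dec that by (simp add: tree_decomposition_def)
    then show ?thesis by (auto simp: Y_def incident_edges_def)
  qed
  with contraction_sequence_from_edge_bags[OF Y size assms]
  obtain steps where steps: "contraction_sequence G steps"
    "sequence_width G steps \<le> max_degree G * (treewidth G + 1)" by blast
  have "contraction_width G \<le> sequence_width G steps"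
    unfolding contraction_width_def using steps(1) by (intro Least_le) blast
  with steps(2) show ?thesis by simp
qed

end
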